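(* Let $N\ge 1$ and let $f:\{0,1\}^N\times(0,1)^N\to\mathbb{R}$ be a linearly-decomposable loss function, i.e. there are an invertible function $g:[0,1]\to\mathbb{R}$ and a function $h:[0,1]^N\to\mathbb{R}$ with $f(\sigma,\theta)=h(\theta)+\sum_{i=1}^N\sigma_i\,g(\theta_i)$ for all $\sigma\in\{0,1\}^N$, $\theta\in(0,1)^N$. Let $p_i$ be the $i$-th prime number and $P=\prod_{i=1}^N p_i$. (a) For any $\tau>0$, if $\theta\in(0,1)^N$ satisfies $g(\theta_i)=3P\tau\ln p_i$ for all $i\in\{1,\dots,N\}$, then $\Lambda_\theta(f)\ge 2\tau$. (b) If $\theta\in(0,1)^N$ satisfies $g(\theta_i)=\ln p_i$ for all $i\in\{1,\dots,N\}$, then $f$ is $0^+$-codomain separable using $\theta$.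
   Context: For $\theta\in(0,1)^N$, $\Lambda_\theta(f):=\min\{|f(\sigma_1,\theta)-f(\sigma_2,\theta)| : \sigma_1,\sigma_2\in\{0,1\}^N,\ \sigma_1\ne\sigma_2\}$. $f$ is $0^+$-codomain separable using $\theta$ if $\Lambda_\theta(f)>0$. Invertible means injective (invertible onto its image). *)

theory Defs
  imports Complex_Main "HOL-Library.FuncSet" "HOL-Library.Infinite_Set"
    "HOL-Computational_Algebra.Primes"
begin

text \<open>Vectors of length \<open>N\<close> are extensional functions on \<open>{1..N}\<close>, so that two vectors
  are equal iff their coordinates \<open>1, ..., N\<close> agree.\<close>

definition binary_vectors :: "nat \<Rightarrow> (nat \<Rightarrow> nat) set" where
  "binary_vectors N = {1..N} \<rightarrow>\<^sub>E {0, 1}"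

definition open_cube :: "nat \<Rightarrow> (nat \<Rightarrow> real) set" where
  "open_cube N = {1..N} \<rightarrow>\<^sub>E {0<..<1}"

text \<open>The minimum is over a finite set, which is nonempty iff \<open>N \<ge> 1\<close>; only that case is meaningful.\<close>

definition codomain_gap ::
    "nat \<Rightarrow> ((nat \<Rightarrow> nat) \<Rightarrow> (nat \<Rightarrow> real) \<Rightarrow> real) \<Rightarrow> (nat \<Rightarrow> real) \<Rightarrow> real" where
  "codomain_gap N f \<theta> =
     Min {\<bar>f \<sigma>\<^sub>1 \<theta> - f \<sigma>\<^sub>2 \<theta>\<bar> | \<sigma>\<^sub>1 \<sigma>\<^sub>2.
            \<sigma>\<^sub>1 \<in> binary_vectors N \<and> \<sigma>\<^sub>2 \<in> binary_vectors N \<and> \<sigma>\<^sub>1 \<noteq> \<sigma>\<^sub>2}"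

definition zero_plus_codomain_separable ::
    "nat \<Rightarrow> ((nat \<Rightarrow> nat) \<Rightarrow> (nat \<Rightarrow> real) \<Rightarrow> real) \<Rightarrow> (nat \<Rightarrow> real) \<Rightarrow> bool" where
  "zero_plus_codomain_separable N f \<theta> \<longleftrightarrow> codomain_gap N f \<theta> > 0"

text \<open>The decomposing functions are parameters because results about such losses refer to \<open>g\<close>.
  Invertibility of \<open>g\<close> means invertibility onto its image; \<open>g\<close> and \<open>h\<close> are total functions
  whose values outside \<open>[0,1]\<close> and \<open>[0,1]^N\<close> are irrelevant.\<close>

definition linearly_decomposable_with ::
    "nat \<Rightarrow> (real \<Rightarrow> real) \<Rightarrow> ((nat \<Rightarrow> real) \<Rightarrow> real) \<Rightarrow>
     ((nat \<Rightarrow> nat) \<Rightarrow> (nat \<Rightarrow> real) \<Rightarrow> real) \<Rightarrow> bool" where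
  "linearly_decomposable_with N g h f \<longleftrightarrow>
     inj_on g {0..1} \<and>
     (\<forall>\<sigma>\<in>binary_vectors N. \<forall>\<theta>\<in>open_cube N.
        f \<sigma> \<theta> = h \<theta> + (\<Sum>i = 1..N. real (\<sigma> i) * g (\<theta> i)))"

text \<open>Counted from one: \<open>nth_prime 1 = 2\<close>, whereas \<open>enumerate\<close> counts from zero.\<close>

definition nth_prime :: "nat \<Rightarrow> nat" where
  "nth_prime i = enumerate {p. prime p} (i - 1)"

definition primorial :: "nat \<Rightarrow> nat" where
  "primorial N = (\<Prod>i = 1..N. nth_prime i)"

end

theory Submission
  imports Defs
begin

text \<open>With \<open>g (\<theta> i) = c * ln p\<^sub>i\<close>, the difference of two losses is \<open>c * (ln a - ln b)\<close> where
  \<open>a\<close> and \<open>b\<close> are the products of the primes selected by the two binary vectors. By unique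
  factorization these are distinct positive integers of size at most \<open>P\<close>, and
  \<open>\<bar>ln a - ln b\<bar> \<ge> \<bar>a - b\<bar> / max a b \<ge> 1 / P\<close>.\<close>

text \<open>Selection is encoded in the exponents so that the logarithm is linear in
  \<open>\<sigma>\<close>, matching the sum in the decomposition of the loss.\<close>

definition prime_product :: "nat \<Rightarrow> (nat \<Rightarrow> nat) \<Rightarrow> nat" where
  "prime_product N \<sigma> = (\<Prod>i = 1..N. nth_prime i ^ \<sigma> i)"

lemma prime_nth_prime: "prime (nth_prime i)"
  using enumerate_in_set[OF primes_infinite] by (auto simp: nth_prime_def)

text \<open>Index 0 is excluded because truncated subtraction makes \<open>nth_prime 0\<close> and
  \<open>nth_prime 1\<close> both equal to 2.\<close>

lemma inj_on_nth_prime: "inj_on nth_prime {1..}"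
proof (rule inj_onI)
  fix i j :: nat
  assume "i \<in> {1..}" "j \<in> {1..}" "nth_prime i = nth_prime j"
  then have "i - 1 = j - 1"
    using strict_mono_eq[OF strict_mono_enumerate[OF primes_infinite]]
    unfolding nth_prime_def by blast
  with \<open>i \<in> {1..}\<close> \<open>j \<in> {1..}\<close> show "i = j" by simp
qed

text \<open>Divisibility reads the support of \<open>\<sigma>\<close> back from the product: a prime
  dividing a product of prime powers is one of the bases, and distinct indices have distinct
  primes.\<close>

lemma nth_prime_dvd_prime_product_iff:
  assumes "i \<in> {1..N}"
  shows "nth_prime i dvd prime_product N \<sigma> \<longleftrightarrow> \<sigma> i \<noteq> 0"
proof
  assume "nth_prime i dvd prime_product N \<sigma>"
  then have "\<exists>j\<in>{1..N}. nth_prime i dvd nth_prime j ^ \<sigma> j"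
    by (simp add: prime_product_def prime_dvd_prod_iff prime_nth_prime)
  then obtain j where j: "j \<in> {1..N}" "nth_prime i dvd nth_prime j ^ \<sigma> j" ..
  from j(2) have "nth_prime i dvd nth_prime j"
    by (rule prime_dvd_power[OF prime_nth_prime])
  then have "nth_prime i = nth_prime j"
    by (rule primes_dvd_imp_eq[OF prime_nth_prime prime_nth_prime])
  then have "i = j"
    using inj_on_nth_prime assms j(1) by (simp add: inj_on_eq_iff)
  \<comment> \<open>If \<open>\<sigma> j\<close> were 0, the prime would divide 1.\<close>
  with j show "\<sigma> i \<noteq> 0"
    using prime_nth_prime[of i] by (cases "\<sigma> j") auto
next
  assume "\<sigma> i \<noteq> 0"
  then have "nth_prime i dvd nth_prime i ^ \<sigma> i" by (simp add: dvd_power)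
  also have "\<dots> dvd prime_product N \<sigma>"
    unfolding prime_product_def using assms by (intro dvd_prodI) auto
  finally show "nth_prime i dvd prime_product N \<sigma>" .
qed

text \<open>The product determines the support, and an entry in {0, 1} is determined by whether it
  vanishes. Outside \<open>{1..N}\<close> extensional functions agree anyway.\<close>

lemma inj_on_prime_product: "inj_on (prime_product N) (binary_vectors N)"
proof (rule inj_onI)
  fix \<sigma> \<rho>
  assume mem: "\<sigma> \<in> binary_vectors N" "\<rho> \<in> binary_vectors N"
    and eq: "prime_product N \<sigma> = prime_product N \<rho>"
  show "\<sigma> = \<rho>"
  proof (rule PiE_ext)
    show "\<sigma> \<in> {1..N} \<rightarrow>\<^sub>E {0, 1}" "\<rho> \<in> {1..N} \<rightarrow>\<^sub>E {0, 1}"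
      using mem by (simp_all add: binary_vectors_def)
    fix i assume i: "i \<in> {1..N}"
    then have "\<sigma> i \<in> {0, 1}" "\<rho> i \<in> {0, 1}"
      using mem unfolding binary_vectors_def by blast+
    moreover have "\<sigma> i \<noteq> 0 \<longleftrightarrow> \<rho> i \<noteq> 0"
      using eq nth_prime_dvd_prime_product_iff[OF i] by metis
    ultimately show "\<sigma> i = \<rho> i" by auto
  qed
qed

lemma prime_product_pos: "prime_product N \<sigma> > 0"
  unfolding prime_product_def by (intro prod_pos) (simp add: prime_gt_0_nat prime_nth_prime)

lemma primorial_pos: "primorial N > 0"
  unfolding primorial_def by (intro prod_pos) (simp add: prime_gt_0_nat prime_nth_prime)

lemma prime_product_le_primorial:
  assumes "\<sigma> \<in> binary_vectors N"
  shows "prime_product N \<sigma> \<le> primorial N"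
  unfolding prime_product_def primorial_def
proof (intro prod_mono conjI)
  fix i assume "i \<in> {1..N}"
  then have "\<sigma> i \<in> {0, 1}" using assms unfolding binary_vectors_def by blast
  then show "nth_prime i ^ \<sigma> i \<le> nth_prime i"
    using prime_gt_0_nat[OF prime_nth_prime[of i]] by auto
qed simp

lemma ln_prime_product:
  "ln (real (prime_product N \<sigma>)) = (\<Sum>i = 1..N. real (\<sigma> i) * ln (real (nth_prime i)))"
proof -
  have "nth_prime i > 0" for i by (simp add: prime_gt_0_nat prime_nth_prime)
  then show ?thesis
    by (simp add: prime_product_def ln_prod ln_realpow)
qed

text \<open>The engine is \<open>ln x \<le> x - 1\<close> at \<open>x = b / a\<close>, which gives
  \<open>ln (a / b) \<ge> 1 - b / a = (a - b) / a\<close>.\<close>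

lemma ln_nat_diff_ge:
  fixes a b m :: nat
  assumes "b > 0" "b < a" "a \<le> m"
  shows "ln (real a) - ln (real b) \<ge> 1 / real m"
proof -
  have "1 / real m \<le> 1 / real a"
    using assms by (intro divide_left_mono) auto
  \<comment> \<open>Integrality enters here: \<open>b < a\<close> forces
    \<open>a - b \<ge> 1\<close>.\<close>
  also have "\<dots> \<le> 1 - real b / real a"
    using assms by (simp add: field_simps)
  also have "\<dots> \<le> ln (real a / real b)"
    using ln_le_minus_one[of "real b / real a"] assms by (simp add: ln_div)
  also have "\<dots> = ln (real a) - ln (real b)"
    using assms by (simp add: ln_div)
  finally show ?thesis .
qed

lemma abs_ln_nat_diff_ge:
  fixes a b m :: nat
  assumes "a > 0" "b > 0" "a \<noteq> b" "a \<le> m" "b \<le> m"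
  shows "\<bar>ln (real a) - ln (real b)\<bar> \<ge> 1 / real m"
  using ln_nat_diff_ge[of b a m] ln_nat_diff_ge[of a b m] assms
  by (cases "b < a") auto

lemma finite_binary_vectors: "finite (binary_vectors N)"
  by (simp add: binary_vectors_def finite_PiE)

text \<open>A pairwise bound passes to \<open>Min\<close> once the set of differences is known to be
  finite and nonempty; the latter is where \<open>N \<ge> 1\<close> enters.\<close>

lemma codomain_gap_geI:
  assumes "N \<ge> 1"
    and bound: "\<And>\<sigma> \<rho>. \<lbrakk>\<sigma> \<in> binary_vectors N; \<rho> \<in> binary_vectors N; \<sigma> \<noteq> \<rho>\<rbrakk>
      \<Longrightarrow> m \<le> \<bar>f \<sigma> \<theta> - f \<rho> \<theta>\<bar>"
  shows "m \<le> codomain_gap N f \<theta>"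
  unfolding codomain_gap_def
proof (rule Min.boundedI)
  let ?S = "{\<bar>f \<sigma> \<theta> - f \<rho> \<theta>\<bar> | \<sigma> \<rho>.
    \<sigma> \<in> binary_vectors N \<and> \<rho> \<in> binary_vectors N \<and> \<sigma> \<noteq> \<rho>}"
  have "?S \<subseteq> (\<lambda>(\<sigma>, \<rho>). \<bar>f \<sigma> \<theta> - f \<rho> \<theta>\<bar>) ` (binary_vectors N \<times> binary_vectors N)"
    by auto
  then show "finite ?S"
    by (rule finite_subset) (simp add: finite_binary_vectors)
  \<comment> \<open>Two distinct binary vectors witness nonemptiness: the constant ones, restricted
    to be extensional. They differ at coordinate 1.\<close>
  let ?zero = "restrict (\<lambda>_. 0) {1..N} :: nat \<Rightarrow> nat"
  let ?one = "restrict (\<lambda>_. 1) {1..N} :: nat \<Rightarrow> nat"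
  have "?zero \<in> binary_vectors N" "?one \<in> binary_vectors N"
    by (auto simp: binary_vectors_def)
  moreover have "?zero 1 \<noteq> ?one 1" using \<open>N \<ge> 1\<close> by simp
  then have "?zero \<noteq> ?one" by metis
  ultimately show "?S \<noteq> {}" by blast
qed (use bound in auto)

text \<open>Common source of both claims, which are the cases \<open>c = 3 * P * \<tau>\<close> and
  \<open>c = 1\<close> with \<open>P\<close> the primorial.\<close>

lemma codomain_gap_ge_of_log_primes:
  assumes "N \<ge> 1" "linearly_decomposable_with N g h f" "\<theta> \<in> open_cube N" "c \<ge> 0"
    and g: "\<forall>i\<in>{1..N}. g (\<theta> i) = c * ln (real (nth_prime i))"
  shows "codomain_gap N f \<theta> \<ge> c / real (primorial N)"
proof (rule codomain_gap_geI[OF \<open>N \<ge> 1\<close>])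
  have f: "f \<sigma> \<theta> = h \<theta> + c * ln (real (prime_product N \<sigma>))"
    if "\<sigma> \<in> binary_vectors N" for \<sigma>
  proof -
    have "f \<sigma> \<theta> = h \<theta> + (\<Sum>i = 1..N. real (\<sigma> i) * g (\<theta> i))"
      using assms(2,3) that unfolding linearly_decomposable_with_def by blast
    also have "(\<Sum>i = 1..N. real (\<sigma> i) * g (\<theta> i)) =
        (\<Sum>i = 1..N. c * (real (\<sigma> i) * ln (real (nth_prime i))))"
      using g by (intro sum.cong) auto
    finally show ?thesis by (simp add: ln_prime_product sum_distrib_left)
  qed
  fix \<sigma> \<rho>
  assume mem: "\<sigma> \<in> binary_vectors N" "\<rho> \<in> binary_vectors N" and "\<sigma> \<noteq> \<rho>"
  then have "prime_product N \<sigma> \<noteq> prime_product N \<rho>"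
    using inj_onD[OF inj_on_prime_product] by blast
  then have "1 / real (primorial N) \<le>
      \<bar>ln (real (prime_product N \<sigma>)) - ln (real (prime_product N \<rho>))\<bar>"
    using mem by (intro abs_ln_nat_diff_ge prime_product_pos prime_product_le_primorial)
  \<comment> \<open>In the difference of the two losses \<open>h \<theta>\<close> cancels and
    \<open>c\<close> factors out of the absolute value.\<close>
  from mult_left_mono[OF this \<open>c \<ge> 0\<close>]
  show "c / real (primorial N) \<le> \<bar>f \<sigma> \<theta> - f \<rho> \<theta>\<bar>"
    using \<open>c \<ge> 0\<close> mem by (simp add: f abs_mult flip: right_diff_distrib)
qed

theorem theorem2:
  fixes N :: nat
    and f :: "(nat \<Rightarrow> nat) \<Rightarrow> (nat \<Rightarrow> real) \<Rightarrow> real"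
    and g :: "real \<Rightarrow> real"
    and h :: "(nat \<Rightarrow> real) \<Rightarrow> real"
  assumes "N \<ge> 1"
    and "linearly_decomposable_with N g h f"
  shows "(\<forall>\<tau>>0. \<forall>\<theta>\<in>open_cube N.
            (\<forall>i\<in>{1..N}. g (\<theta> i) = 3 * real (primorial N) * \<tau> * ln (real (nth_prime i)))
            \<longrightarrow> codomain_gap N f \<theta> \<ge> 2 * \<tau>)
       \<and> (\<forall>\<theta>\<in>open_cube N.
            (\<forall>i\<in>{1..N}. g (\<theta> i) = ln (real (nth_prime i)))
            \<longrightarrow> zero_plus_codomain_separable N f \<theta>)"
proof (intro conjI allI ballI impI)
  fix \<tau> :: real and \<theta>
  assume \<tau>: "\<tau> > 0" and \<theta>: "\<theta> \<in> open_cube N"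
    and g: "\<forall>i\<in>{1..N}. g (\<theta> i) = 3 * real (primorial N) * \<tau> * ln (real (nth_prime i))"
  \<comment> \<open>Cancelling the primorial leaves \<open>3 * \<tau>\<close>, which exceeds the
    required \<open>2 * \<tau>\<close>.\<close>
  have "2 * \<tau> \<le> (3 * real (primorial N) * \<tau>) / real (primorial N)"
    using \<tau> primorial_pos[of N] by simp
  also have "\<dots> \<le> codomain_gap N f \<theta>"
    using \<tau> by (intro codomain_gap_ge_of_log_primes[OF assms \<theta> _ g]) simp
  finally show "codomain_gap N f \<theta> \<ge> 2 * \<tau>" .
next
  fix \<theta>
  assume \<theta>: "\<theta> \<in> open_cube N"
    and g: "\<forall>i\<in>{1..N}. g (\<theta> i) = ln (real (nth_prime i))"
  \<comment> \<open>With \<open>c = 1\<close> the gap has the explicit positive lower bound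
    \<open>1 / P\<close>.\<close>
  have "0 < 1 / real (primorial N)"
    using primorial_pos[of N] by simp
  also have "\<dots> \<le> codomain_gap N f \<theta>"
    using g by (intro codomain_gap_ge_of_log_primes[OF assms \<theta>]) simp_all
  finally show "zero_plus_codomain_separable N f \<theta>"
    by (simp add: zero_plus_codomain_separable_def)
qed

end
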